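(* Let $\overline{\Gamma_1}=\overline{C_7(1,2)}$ and $\overline{\Gamma_2}=\overline{C_7(1,3)}$ be the complements of the circulant graphs $C_7(1,2)$ and $C_7(1,3)$. Then their distance spectral radii satisfy $$\rho(\overline{\Gamma_1})=\rho(\overline{\Gamma_2})=12.$$
   Context: For $S\subseteq\mathbb{Z}_n\setminus\{0\}$, the circulant graph $C_n(S)$ is the simple undirected graph with vertex set $\mathbb{Z}_n=\{0,1,\ldots,n-1\}$ and edge set $\{\{g,g+s\}: g\in\mathbb{Z}_n, s\in S\}$ (addition mod $n$); $C_n(1,a)$ means $C_n(\{1,a\})$. $\overline{\Gamma}$ denotes the complement of $\Gamma$. For a connected graph $\Gamma$ with vertices $v_1,\ldots,v_n$, the distance matrix $\mathbf{D}(\Gamma)$ is the $n\times n$ matrix with $(i,j)$-entry $d_{\Gamma}(v_i,v_j)$, the length of a shortest path between $v_i$ and $v_j$ ($0$ if $i=j$). The distance spectral radius $\rho(\Gamma)$ is the largest eigenvalue of $\mathbf{D}(\Gamma)$. *)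

theory Defs
  imports "Graph_Theory.Graph_Theory" "Jordan_Normal_Form.Spectral_Radius"
begin

text \<open>
  Undirected graphs are symmetric digraphs, as in \<^locale>\<open>pair_graph\<close>: an edge \<open>{u, v}\<close>
  is the pair of arcs \<open>(u, v)\<close> and \<open>(v, u)\<close>. Residues modulo \<open>n\<close> are represented by \<open>0, \<dots>, n - 1\<close>,
  and the connection set \<open>S\<close> is meant to be a subset of \<open>{1..<n}\<close>, not necessarily closed under negation.
\<close>

definition circulant_graph :: "nat \<Rightarrow> nat set \<Rightarrow> nat pair_pre_digraph" where
  "circulant_graph n S =
    \<lparr> pverts = {0..<n},
      parcs = (\<Union>g\<in>{0..<n}. \<Union>s\<in>S. {(g, (g + s) mod n), ((g + s) mod n, g)}) \<rparr>"

definition graph_complement :: "'a pair_pre_digraph \<Rightarrow> 'a pair_pre_digraph" where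
  "graph_complement G =
    \<lparr> pverts = pverts G,
      parcs = {(u, v). u \<in> pverts G \<and> v \<in> pverts G \<and> u \<noteq> v \<and> (u, v) \<notin> parcs G} \<rparr>"

lemma pair_graphI:
  assumes "finite (pverts G)" "parcs G \<subseteq> pverts G \<times> pverts G" "sym (parcs G)"
    and "\<And>v. (v, v) \<notin> parcs G"
  shows "pair_graph G"
proof
  show "finite (parcs G)"
    using finite_subset[OF assms(2)] assms(1) by simp
  show "symmetric G"
    using assms(3) by (simp add: symmetric_def arcs_ends_def arc_to_ends_def)
  show "fst e \<noteq> snd e" if "e \<in> parcs G" for e
    using that assms(4) by (metis prod.collapse)
qed (use assms in auto)

lemma pair_graph_circulant_graph:
  assumes "S \<subseteq> {1..<n}"
  shows "pair_graph (circulant_graph n S)"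
proof (rule pair_graphI)
  have "(g + s) mod n \<noteq> g" if "g < n" "s \<in> S" for g s
  proof -
    have "0 < s" "s < n"
      using that assms by auto
    then show ?thesis
      using that by (auto simp: mod_if)
  qed
  then show "(v, v) \<notin> parcs (circulant_graph n S)" for v
    by (force simp: circulant_graph_def)
qed (auto simp: circulant_graph_def sym_def)

lemma pair_graph_graph_complement:
  assumes "pair_graph G"
  shows "pair_graph (graph_complement G)"
proof (rule pair_graphI)
  interpret pair_graph G by fact
  show "finite (pverts (graph_complement G))"
    by (simp add: graph_complement_def)
  show "sym (parcs (graph_complement G))"
    using arcs_symmetric by (auto simp: graph_complement_def sym_def)
qed (auto simp: graph_complement_def)

text \<open>The value is unspecified if there is no path from \<open>u\<close> to \<open>v\<close>.\<close>

definition graph_distance :: "('a, 'b) pre_digraph \<Rightarrow> 'a \<Rightarrow> 'a \<Rightarrow> nat" where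
  "graph_distance G u v = (LEAST k. \<exists>p. pre_digraph.apath G u p v \<and> length p = k)"

text \<open>The vertices are enumerated in increasing order.\<close>

definition distance_matrix :: "('a :: linorder, 'b) pre_digraph \<Rightarrow> real mat" where
  "distance_matrix G =
    (let vs = sorted_list_of_set (verts G)
     in mat (length vs) (length vs) (\<lambda>(i, j). real (graph_distance G (vs ! i) (vs ! j))))"

text \<open>
  The maximum ranges over the real eigenvalues. For an undirected graph the distance matrix
  is real symmetric, so these are all its eigenvalues.
\<close>

definition distance_spectral_radius :: "('a :: linorder, 'b) pre_digraph \<Rightarrow> real" where
  "distance_spectral_radius G = Max (spectrum (distance_matrix G))"

end

theory Submission
  imports Defs "HOL-Number_Theory.Cong"
begin

text \<open>
  Modulo \<open>7\<close>, the nonzero residues are \<open>\<plusminus>1\<close>, \<open>\<plusminus>2\<close>, \<open>\<plusminus>3\<close>. Hence the complement of \<open>C\<^sub>7(1,2)\<close> is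
  \<open>C\<^sub>7(3)\<close> and the complement of \<open>C\<^sub>7(1,3)\<close> is \<open>C\<^sub>7(2)\<close>. Since \<open>2\<close> and \<open>3\<close> are units modulo \<open>7\<close>,
  both graphs are cycles of length \<open>7\<close>, traversed in steps of \<open>2\<close> or \<open>3\<close>. In such a cycle the distances
  from any vertex to all vertices are \<open>0, 1, 2, 3, 3, 2, 1\<close>, which sum to \<open>12\<close>. So every row of the
  distance matrix sums to \<open>12\<close>; the all-ones vector is then an eigenvector for \<open>12\<close>, and a nonnegative
  matrix with constant row sum has no larger real eigenvalue
  (lemma \<open>Max_spectrum_constant_row_sum\<close>).

  The argument works for every cycle \<open>C\<^sub>n(c)\<close> with \<open>c\<close> coprime to \<open>n\<close>
  (lemma \<open>distance_spectral_radius_circulant_cycle\<close>). Its distances come from a potential argument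
  (lemma \<open>graph_distance_eqI\<close>), which avoids the analysis of individual paths.
\<close>

text \<open>
  A potential that vanishes at \<open>u\<close> and grows by at most one along each arc is a lower bound for the
  length of every walk from \<open>u\<close>. If moreover each other vertex is entered by an arc along which the
  potential grows by exactly one, then following such arcs backwards reaches \<open>u\<close> and gives a walk
  that attains the bound.
\<close>

lemma (in wf_digraph) graph_distance_eqI:
  fixes f :: "'a \<Rightarrow> nat"
  assumes u: "u \<in> verts G" and f0: "f u = 0"
    and lip: "\<And>e. e \<in> arcs G \<Longrightarrow> f (head G e) \<le> Suc (f (tail G e))"
    and pred: "\<And>v. v \<in> verts G \<Longrightarrow> v \<noteq> u \<Longrightarrow> \<exists>e\<in>arcs G. head G e = v \<and> f v = Suc (f (tail G e))"
    and v: "v \<in> verts G"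
  shows "graph_distance G u v = f v"
proof -
  have lower: "f y \<le> f x + length p" if "awalk x p y" for x p y
    using that
  proof (induction p arbitrary: x)
    case Nil
    then show ?case by (simp add: awalk_Nil_iff)
  next
    case (Cons e p)
    then have "e \<in> arcs G" "tail G e = x" "awalk (head G e) p y"
      by (simp_all add: awalk_Cons_iff)
    then show ?case
      using Cons.IH[of "head G e"] lip[of e] by simp
  qed
  have "\<exists>p. awalk u p w \<and> length p = f w" if "w \<in> verts G" for w
    using that
  proof (induction "f w" arbitrary: w rule: less_induct)
    case less
    show ?case
    proof (cases "w = u")
      case True
      then show ?thesis using u f0 by (auto simp: awalk_Nil_iff intro!: exI[of _ "[]"])
    next
      case False
      then obtain e where e: "e \<in> arcs G" "head G e = w" "f w = Suc (f (tail G e))"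
        using pred less.prems by blast
      then obtain p where p: "awalk u p (tail G e)" "length p = f (tail G e)"
        using less.hyps[of "tail G e"] by auto
      then have "awalk u (p @ [e]) w"
        using e by (auto simp: awalk_simps)
      then show ?thesis
        using p e by (intro exI[of _ "p @ [e]"]) simp
    qed
  qed
  then obtain p where p: "awalk u p v" "length p = f v"
    using v by blast
  \<comment> \<open>Distances are defined by paths, so the walk is shortened to one. Its length is counted through
    its set of arcs, which are among those of the walk.\<close>
  have q: "apath u (awalk_to_apath p) v"
    using p(1) by (rule apath_awalk_to_apath)
  have "length (awalk_to_apath p) = card (set (awalk_to_apath p))"
    using q distinct_verts_imp_distinct by (metis apath_def distinct_card)
  also have "\<dots> \<le> card (set p)"
    using awalk_to_apath_subset[OF p(1)] by (intro card_mono) auto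
  also have "\<dots> \<le> f v"
    using p(2) card_length by metis
  finally have "length (awalk_to_apath p) \<le> f v" .
  moreover have "f v \<le> length q" if "apath u q v" for q
    using lower[OF awalkI_apath[OF that]] f0 by simp
  ultimately show ?thesis
    unfolding graph_distance_def using q
    by (intro Least_equality) (auto intro!: exI[of _ "awalk_to_apath p"] antisym)
qed

text \<open>
  The elementary part of Perron--Frobenius theory. The all-ones vector shows that \<open>r\<close> is an eigenvalue.
  Conversely, reading \<open>A v = k v\<close> at an entry of \<open>v\<close> of maximal modulus \<open>m\<close> gives \<open>\<bar>k\<bar> m \<le> r m\<close>.
\<close>

lemma Max_spectrum_constant_row_sum:
  fixes A :: "real mat"
  assumes A: "A \<in> carrier_mat n n" and n: "0 < n"
    and nonneg: "\<And>i j. i < n \<Longrightarrow> j < n \<Longrightarrow> 0 \<le> A $$ (i, j)"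
    and row: "\<And>i. i < n \<Longrightarrow> (\<Sum>j<n. A $$ (i, j)) = r"
  shows "Max (spectrum A) = r"
proof (rule Max_eqI)
  show "finite (spectrum A)"
    using card_finite_spectrum(1)[OF A] .
next
  have entry: "(A *\<^sub>v v) $ i = (\<Sum>j<n. A $$ (i, j) * v $ j)" if "v \<in> carrier_vec n" "i < n" for v i
    using that A by (simp add: scalar_prod_def lessThan_atLeast0)
  {
    have "A *\<^sub>v vec n (\<lambda>_. 1) = r \<cdot>\<^sub>v vec n (\<lambda>_. 1)"
      using A by (intro eq_vecI) (simp_all add: entry row del: index_mult_mat_vec)
    moreover have "vec n (\<lambda>_. 1) \<noteq> (0\<^sub>v n :: real vec)"
      using n by (metis index_vec index_zero_vec(1) zero_neq_one)
    ultimately show "r \<in> spectrum A"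
      using A unfolding spectrum_def eigenvalue_def eigenvector_def
      by (auto intro!: exI[of _ "vec n (\<lambda>_. 1)"])
  next
    fix k assume "k \<in> spectrum A"
    then obtain v where v: "v \<in> carrier_vec n" "v \<noteq> 0\<^sub>v n" "A *\<^sub>v v = k \<cdot>\<^sub>v v"
      using A unfolding spectrum_def eigenvalue_def eigenvector_def by auto
    define m where "m = Max ((\<lambda>i. \<bar>v $ i\<bar>) ` {..<n})"
    have "m \<in> (\<lambda>i. \<bar>v $ i\<bar>) ` {..<n}"
      unfolding m_def using n by (intro Max_in) auto
    then obtain i where i: "i < n" "\<bar>v $ i\<bar> = m" by auto
    have le: "\<bar>v $ j\<bar> \<le> m" if "j < n" for j
      unfolding m_def using that by (intro Max_ge) auto
    have "m > 0"
    proof (rule ccontr)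
      assume "\<not> m > 0"
      then have "v $ j = 0" if "j < n" for j
        using le[OF that] by linarith
      then show False
        using v(1,2) by (auto intro: eq_vecI)
    qed
    have "k * v $ i = (\<Sum>j<n. A $$ (i, j) * v $ j)"
      using entry[OF v(1) i(1)] v i by simp
    then have "\<bar>k\<bar> * m = \<bar>\<Sum>j<n. A $$ (i, j) * v $ j\<bar>"
      using i by (metis abs_mult)
    also have "\<dots> \<le> (\<Sum>j<n. A $$ (i, j) * m)"
      using nonneg i(1) le by (intro order_trans[OF sum_abs] sum_mono)
        (auto simp: abs_mult intro: mult_left_mono)
    also have "\<dots> = r * m"
      using row[OF i(1)] by (simp add: sum_distrib_right[symmetric])
    finally show "k \<le> r"
      using \<open>m > 0\<close> by simp
  }
qed

text \<open>
  The transmission of a vertex is the sum of its distances to all vertices, that is, its row sum in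
  the distance matrix.
\<close>

lemma distance_spectral_radius_transmission_regular:
  fixes G :: "(nat, 'b) pre_digraph"
  assumes "verts G = {0..<n}" "0 < n"
    and "\<And>u. u < n \<Longrightarrow> (\<Sum>v<n. graph_distance G u v) = t"
  shows "distance_spectral_radius G = real t"
proof -
  have "distance_matrix G = mat n n (\<lambda>(i, j). real (graph_distance G i j))"
    by (rule eq_matI) (simp_all add: distance_matrix_def assms(1) Let_def)
  moreover have "(\<Sum>j<n. real (graph_distance G i j)) = real t" if "i < n" for i
    using assms(3)[OF that] by (metis of_nat_sum)
  ultimately show ?thesis
    unfolding distance_spectral_radius_def
    using assms(2) by (intro Max_spectrum_constant_row_sum[of _ n]) simp_all
qed


lemma arcs_circulant_graph_iff:
  "(u, v) \<in> parcs (circulant_graph n S) \<longleftrightarrow>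
    u < n \<and> v < n \<and> (\<exists>s\<in>S. v = (u + s) mod n \<or> u = (v + s) mod n)"
  by (auto simp: circulant_graph_def)

text \<open>
  Because \<open>c\<close> is a unit modulo \<open>n\<close>, walking from \<open>u\<close> in steps of \<open>c\<close> meets each vertex exactly once
  before it returns to \<open>u\<close>. The vertex met after \<open>k < n\<close> steps can also be reached by \<open>n - k\<close> steps in
  the other direction, whence its distance \<open>min k (n - k)\<close>.
\<close>

lemma distance_spectral_radius_circulant_cycle:
  assumes c: "0 < c" "c < n" and cop: "coprime c n"
  shows "distance_spectral_radius (circulant_graph n {c}) = real (\<Sum>k<n. min k (n - k))"
proof (rule distance_spectral_radius_transmission_regular[where n = n])
  let ?G = "circulant_graph n {c}"
  interpret pair_graph ?G
    using c by (intro pair_graph_circulant_graph) simp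
  show verts: "verts ?G = {0..<n}"
    by (simp add: circulant_graph_def)
  show "0 < n" using c by simp
  fix u assume u: "u < n"
  define h where "h k = (u + c * k) mod n" for k
  have h_less: "h k < n" for k
    using c by (simp add: h_def)
  have "inj_on h {..<n}"
  proof (rule inj_onI)
    fix k l assume "k \<in> {..<n}" "l \<in> {..<n}" "h k = h l"
    then show "k = l"
      using cop by (metis cong_add_lcancel_nat cong_def cong_mult_lcancel_nat h_def lessThan_iff mod_less)
  qed
  then have bij: "bij_betw h {..<n} {..<n}"
    using h_less by (intro bij_betw_imageI endo_inj_surj) auto
  define f where "f v = (let k = the_inv_into {..<n} h v in min k (n - k))" for v
  \<comment> \<open>The value \<open>k = n\<close> is included, as it closes the cycle: \<open>h n = h 0\<close>, where the formula gives \<open>0\<close>.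
    The arc from \<open>h (n - 1)\<close> to \<open>h n\<close> then needs no separate treatment.\<close>
  have f_h: "f (h k) = min k (n - k)" if "k \<le> n" for k
  proof (cases "k < n")
    case True
    then show ?thesis
      using \<open>inj_on h {..<n}\<close> by (simp add: f_def the_inv_into_f_f)
  next
    case False
    then have "h k = h 0" using that by (simp add: h_def)
    moreover have "the_inv_into {..<n} h (h 0) = 0"
      using \<open>inj_on h {..<n}\<close> \<open>0 < n\<close> by (intro the_inv_into_f_f) auto
    ultimately show ?thesis
      using False that by (simp add: f_def)
  qed
  have ex_h: "\<exists>k<n. v = h k" if "v < n" for v
    using bij that by (auto simp: bij_betw_def image_iff set_eq_iff)
  have h_Suc: "h (Suc k) = (h k + c) mod n" for k
    by (simp add: h_def mod_simps algebra_simps)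
  have arc_h: "(h k, h (Suc k)) \<in> parcs ?G" "(h (Suc k), h k) \<in> parcs ?G" for k
    using h_less[of k] h_less[of "Suc k"] by (simp_all add: arcs_circulant_graph_iff h_Suc)
  have "graph_distance ?G u v = f v" if "v < n" for v
  proof (rule wf_digraph.graph_distance_eqI[where f = f])
    show "wf_digraph (with_proj ?G)" by unfold_locales
    show "u \<in> verts ?G" "v \<in> verts ?G"
      using u that verts by auto
    have "h 0 = u" using u by (simp add: h_def)
    then show "f u = 0" using f_h[of 0] by simp
    show "f (head ?G e) \<le> Suc (f (tail ?G e))" if "e \<in> arcs ?G" for e
    proof -
      obtain x y where e: "e = (x, y)" by (cases e)
      then have xy: "x < n" "y < n" "y = (x + c) mod n \<or> x = (y + c) mod n"
        using that by (auto simp: arcs_circulant_graph_iff)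
      obtain k where "k < n" "x = h k \<and> y = h (Suc k) \<or> y = h k \<and> x = h (Suc k)"
        using xy(3)
      proof
        assume "y = (x + c) mod n"
        with ex_h[OF xy(1)] that show thesis by (auto simp: h_Suc)
      next
        assume "x = (y + c) mod n"
        with ex_h[OF xy(2)] that show thesis by (auto simp: h_Suc)
      qed
      then show ?thesis
        using e f_h[of k] f_h[of "Suc k"] by auto
    qed
    show "\<exists>e\<in>arcs ?G. head ?G e = w \<and> f w = Suc (f (tail ?G e))"
      if w: "w \<in> verts ?G" "w \<noteq> u" for w
    proof -
      obtain k where k: "k < n" "w = h k"
        using w ex_h verts by auto
      then have "k \<noteq> 0" using w(2) k(2) \<open>h 0 = u\<close> by metis
      then obtain l where l: "k = Suc l" by (cases k) auto
      \<comment> \<open>The neighbour nearer to \<open>u\<close> is behind \<open>w\<close> on the first half of the cycle, ahead of it on the second.\<close>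
      show ?thesis
      proof (cases "k \<le> n - k")
        case True
        then have "f w = Suc (f (h l))"
          using k l f_h[of k] f_h[of l] by auto
        then show ?thesis
          using k l arc_h(1)[of l] by (intro bexI[of _ "(h l, w)"]) simp_all
      next
        case False
        then have "f w = Suc (f (h (Suc k)))"
          using k f_h[of k] f_h[of "Suc k"] by auto
        then show ?thesis
          using k arc_h(2)[of k] by (intro bexI[of _ "(h (Suc k), w)"]) simp_all
      qed
    qed
  qed
  then have "(\<Sum>v<n. graph_distance ?G u v) = (\<Sum>v<n. f v)"
    by simp
  also have "\<dots> = (\<Sum>k<n. f (h k))"
    using sum.reindex_bij_betw[OF bij, of f] by simp
  also have "\<dots> = (\<Sum>k<n. min k (n - k))"
    using f_h by simp
  finally show "(\<Sum>v<n. graph_distance ?G u v) = (\<Sum>k<n. min k (n - k))" .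
qed

lemma distance_spectral_radius_circulant_heptagon:
  assumes "0 < c" "c < 7"
  shows "distance_spectral_radius (circulant_graph 7 {c}) = 12"
proof -
  have "prime (7 :: nat)"
    by simp
  then have "coprime c 7"
    using assms by (metis coprime_commute nat_dvd_not_less prime_imp_coprime)
  moreover have "(\<Sum>k<7. min k (7 - k)) = (12 :: nat)"
    by (simp add: lessThan_nat_numeral)
  ultimately show ?thesis
    using distance_spectral_radius_circulant_cycle[of c 7] assms by simp
qed

lemma complement_circulant_graph_eqI:
  assumes "\<And>u v. u < n \<Longrightarrow> v < n \<Longrightarrow>
      u \<noteq> v \<and> (\<forall>s\<in>S. v \<noteq> (u + s) mod n \<and> u \<noteq> (v + s) mod n) \<longleftrightarrow>
      (\<exists>t\<in>T. v = (u + t) mod n \<or> u = (v + t) mod n)"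
  shows "graph_complement (circulant_graph n S) = circulant_graph n T"
proof (rule pair_pre_digraph.equality)
  have "(u, v) \<in> parcs (graph_complement (circulant_graph n S)) \<longleftrightarrow>
      (u, v) \<in> parcs (circulant_graph n T)" for u v
  proof -
    have "(u, v) \<in> parcs (graph_complement (circulant_graph n S)) \<longleftrightarrow>
        u < n \<and> v < n \<and> u \<noteq> v \<and> (u, v) \<notin> parcs (circulant_graph n S)"
      by (simp add: graph_complement_def) (simp add: circulant_graph_def)
    then show ?thesis
      using assms[of u v] unfolding arcs_circulant_graph_iff by blast
  qed
  then show "parcs (graph_complement (circulant_graph n S)) = parcs (circulant_graph n T)"
    by auto
qed (simp_all add: graph_complement_def circulant_graph_def)

text \<open>Splitting residues into literals reduces the two complement identities to ground arithmetic.\<close>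

lemma less_7_cases: "u < 7 \<Longrightarrow> u \<in> {0, 1, 2, 3, 4, 5, 6 :: nat}"
  by auto

lemma complement_circulant_graph_7_1_2:
  "graph_complement (circulant_graph 7 {1, 2}) = circulant_graph 7 {3}"
  by (rule complement_circulant_graph_eqI) (drule less_7_cases, drule less_7_cases, elim insertE emptyE; simp)

lemma complement_circulant_graph_7_1_3:
  "graph_complement (circulant_graph 7 {1, 3}) = circulant_graph 7 {2}"
  by (rule complement_circulant_graph_eqI) (drule less_7_cases, drule less_7_cases, elim insertE emptyE; simp)

theorem theorem4p3:
  shows "distance_spectral_radius (graph_complement (circulant_graph 7 {1, 2})) =
           distance_spectral_radius (graph_complement (circulant_graph 7 {1, 3}))
       \<and> distance_spectral_radius (graph_complement (circulant_graph 7 {1, 3})) = 12"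
  by (simp add: complement_circulant_graph_7_1_2 complement_circulant_graph_7_1_3
      distance_spectral_radius_circulant_heptagon del: One_nat_def)

end
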